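(* The sup-norm Brownian frame process $\mathcal{T}^{B}=(\mathcal{T}^{B}_h)_{h\in[0,1]}$ has continuous sample paths; that is, for every $f\in C_0([-1,1])$ the map $h\mapsto \mathcal{T}^{B}_h(f)=\mathcal{T}^f_h$ is continuous from $[0,1]$ into $(C([0,1]),\|\cdot\|_\infty)$.
   Context: $C_0([-1,1])$ is the space of continuous functions $f:[-1,1]\to\mathbb{R}$ with $f(-1)=0$, with the sup-norm $\|\cdot\|_\infty$. For $h\in[0,1]$ and $f\in C_0([-1,1])$ define $\mathcal{T}^f_h\in C([0,1])$ by $\mathcal{T}^f_h(u):=f(h-1+u)$, $u\in[0,1]$. The sup-norm frame process is $\mathcal{T}^B_h: C_0([-1,1])\to (C([0,1]),\|\cdot\|_\infty)$, $\mathcal{T}^B_h(f):=\mathcal{T}^f_h$. *)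

theory Defs
  imports "HOL-Analysis.Analysis"
begin

text \<open>
  The space of continuous functions from the interval \<open>[a, b]\<close> to \<open>\<real>\<close> with the metric of the
  sup-norm, as an instance of the library's \<^const>\<open>cfunspace\<close>. Its elements are functions on
  all of \<open>\<real>\<close> that are \<^const>\<open>undefined\<close> outside \<open>[a, b]\<close>, so that equality in the space
  is equality on \<open>[a, b]\<close>.
\<close>

definition cont_space :: "real \<Rightarrow> real \<Rightarrow> (real \<Rightarrow> real) metric" where
  "cont_space a b = cfunspace (top_of_set {a..b}) euclidean_metric"

definition cont_space0 :: "(real \<Rightarrow> real) metric" where
  "cont_space0 = submetric (cont_space (- 1) 1) {f. f (- 1) = 0}"

definition frame_path :: "(real \<Rightarrow> real) \<Rightarrow> real \<Rightarrow> real \<Rightarrow> real" where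
  "frame_path f h = (\<lambda>u\<in>{0..1}. f (h - 1 + u))"

text \<open>
  The driving path \<open>B\<close> is the coordinate process on the path space \<open>C\<^sub>0([-1, 1])\<close>, so
  \<open>frame_process h\<close> is a function of the path \<open>f\<close>, and the sample path belonging to \<open>f\<close> is
  \<open>\<lambda>h. frame_process h f\<close>.
\<close>

definition frame_process :: "real \<Rightarrow> (real \<Rightarrow> real) \<Rightarrow> real \<Rightarrow> real" where
  "frame_process h = (\<lambda>f\<in>mspace cont_space0. frame_path f h)"

lemma mspace_cont_space:
  "mspace (cont_space a b) = {f \<in> extensional {a..b}. continuous_on {a..b} f}"
proof -
  have "compactin (top_of_set {a..b}) (topspace (top_of_set {a..b}))"
    by (simp add: compactin_subtopology)
  then show ?thesis
    unfolding cont_space_def by (subst compactin_mspace_cfunspace) auto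
qed

lemma mdist_cont_space:
  assumes "f \<in> mspace (cont_space a b)" "g \<in> mspace (cont_space a b)" "a \<le> b"
  shows "mdist (cont_space a b) f g = (SUP u\<in>{a..b}. \<bar>f u - g u\<bar>)"
proof -
  have "f \<in> mspace (funspace {a..b} euclidean_metric)"
       "g \<in> mspace (funspace {a..b} euclidean_metric)"
    using assms(1,2) cfunspace_subset_funspace[of "top_of_set {a..b}" "euclidean_metric :: real metric"]
    unfolding cont_space_def topspace_euclidean_subtopology by blast+
  moreover have "{a..b} \<noteq> {}"
    using assms(3) by simp
  ultimately show ?thesis
    unfolding cont_space_def mdist_cfunspace_eq_mdist_funspace
    by (simp add: Metric_space.fdist_def[OF Metric_space_mspace_mdist, of euclidean_metric, simplified]
        dist_real_def)
qed

lemma mspace_cont_space0: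
  "mspace cont_space0 = {f \<in> extensional {-1..1}. continuous_on {-1..1} f \<and> f (- 1) = 0}"
  by (auto simp: cont_space0_def mspace_cont_space)

end

theory Submission
  imports Defs
begin

text \<open>
  The path \<open>f\<close> is continuous on the compact interval \<open>[-1, 1]\<close>, hence uniformly continuous.
  Two frames at \<open>h\<close> and \<open>k\<close> compare \<open>f\<close> at the points \<open>h - 1 + u\<close> and \<open>k - 1 + u\<close>, whose
  distance \<open>\<bar>h - k\<bar>\<close> does not depend on \<open>u\<close>. The modulus of continuity of \<open>f\<close> therefore bounds
  \<open>\<bar>f (h - 1 + u) - f (k - 1 + u)\<bar>\<close> for all \<open>u\<close> at once, that is, the sup-distance of the frames.
\<close>

lemma frame_path_in_cont_space:
  assumes "continuous_on {-1..1} f" "h \<in> {0..1}"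
  shows "frame_path f h \<in> mspace (cont_space 0 1)"
proof -
  have "continuous_on {0..1} (\<lambda>u. f (h - 1 + u))"
    by (rule continuous_on_compose2[OF assms(1)]) (use assms(2) in \<open>auto intro!: continuous_intros\<close>)
  then have "continuous_on {0..1} (frame_path f h)"
    unfolding frame_path_def by (rule continuous_on_eq) simp
  then show ?thesis
    by (simp add: mspace_cont_space frame_path_def)
qed

lemma mdist_frame_path_le:
  assumes "continuous_on {-1..1} f" "h \<in> {0..1}" "k \<in> {0..1}"
    and modulus: "\<And>x y. \<lbrakk>x \<in> {-1..1}; y \<in> {-1..1}; dist x y < d\<rbrakk> \<Longrightarrow> dist (f x) (f y) \<le> e"
    and "dist h k < d"
  shows "mdist (cont_space 0 1) (frame_path f h) (frame_path f k) \<le> e"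
proof -
  have "\<bar>frame_path f h u - frame_path f k u\<bar> \<le> e" if "u \<in> {0..1}" for u
    using modulus[of "h - 1 + u" "k - 1 + u"] that assms(2,3,5)
    by (auto simp: frame_path_def dist_real_def)
  then have "(SUP u\<in>{0..1}. \<bar>frame_path f h u - frame_path f k u\<bar>) \<le> e"
    by (intro cSUP_least) auto
  then show ?thesis
    using assms(1-3) by (simp add: mdist_cont_space frame_path_in_cont_space)
qed

lemma continuous_map_frame_path:
  assumes "continuous_on {-1..1} f"
  shows "continuous_map (top_of_set {0..1}) (mtopology_of (cont_space 0 1)) (frame_path f)"
proof -
  have unif: "uniformly_continuous_on {-1..1} f"
    using assms by (intro compact_uniformly_continuous) auto
  have "uniformly_continuous_map (submetric euclidean_metric {0..1}) (cont_space 0 1) (frame_path f)"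
    unfolding uniformly_continuous_map_def
  proof (intro conjI allI impI)
    show "frame_path f \<in> mspace (submetric euclidean_metric {0..1}) \<rightarrow> mspace (cont_space 0 1)"
      using assms by (auto intro: frame_path_in_cont_space)
  next
    fix e :: real
    assume "e > 0"
    \<comment> \<open>The supremum turns the strict bound of the modulus into a weak one, hence the half.\<close>
    then obtain d where "d > 0"
      and d: "\<And>x y. \<lbrakk>x \<in> {-1..1}; y \<in> {-1..1}; dist x y < d\<rbrakk> \<Longrightarrow> dist (f x) (f y) < e / 2"
      using unif unfolding uniformly_continuous_on_def by (metis dist_commute half_gt_zero)
    have "mdist (cont_space 0 1) (frame_path f k) (frame_path f h) < e"
      if "h \<in> {0..1}" "k \<in> {0..1}" "dist k h < d" for h k
      using mdist_frame_path_le[OF assms that(2,1) less_imp_le[OF d] that(3)] \<open>e > 0\<close> by simp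
    then show "\<exists>\<delta>>0. \<forall>h\<in>mspace (submetric euclidean_metric {0..1}).
        \<forall>k\<in>mspace (submetric euclidean_metric {0..1}).
          mdist (submetric euclidean_metric {0..1}) k h < \<delta> \<longrightarrow>
          mdist (cont_space 0 1) (frame_path f k) (frame_path f h) < e"
      using \<open>d > 0\<close> by auto
  qed
  from uniformly_continuous_imp_continuous_map[OF this] show ?thesis
    by (simp add: mtopology_of_submetric)
qed

theorem lemma16:
  shows "\<forall>f \<in> mspace cont_space0.
           continuous_map (top_of_set {0..1::real}) (mtopology_of (cont_space 0 1))
             (\<lambda>h. frame_process h f)"
proof
  fix f
  assume f: "f \<in> mspace cont_space0"
  then have "(\<lambda>h. frame_process h f) = frame_path f"
    by (simp add: frame_process_def)
  with f show "continuous_map (top_of_set {0..1::real}) (mtopology_of (cont_space 0 1))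
      (\<lambda>h. frame_process h f)"
    by (simp add: mspace_cont_space0 continuous_map_frame_path)
qed

end
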